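(* Let $N\ge2$ be an integer, let $F\in\mathcal{C}$ and let $F_{j,k}=F(\theta_j,\phi_k)$ for $j=0,\dots,N$, $k=0,\dots,2N-1$, where $\theta_j=j\pi/N$ and $\phi_k=k\pi/N$. Then there is exactly one $\mathcal{Q}_NF\in\chi_N$ such that $(\mathcal{Q}_NF)(\theta_j,\phi_k)=F(\theta_j,\phi_k)$ for all $j=0,\dots,N$, $k=0,\dots,2N-1$, and it is given by $$\begin{aligned}(\mathcal{Q}_NF)(\theta,\phi)&=\frac2N\sum_{0\le m\le N/2}\Big[\sum_{\ell=0}^{N}{}''\,\alpha_\ell^{2m}\cos\ell\theta\Big]e^{2m{\rm i}\phi}+\frac2N\sum_{-N/2<m\le-1}\Big[\sum_{\ell=0}^{N}{}''\,\alpha_\ell^{2m+2N}\cos\ell\theta\Big]e^{2m{\rm i}\phi}\\&\quad+\frac2N\sum_{1\le n\le(N+1)/2}\Big[\sum_{\ell=1}^{N-1}\beta_\ell^{2n-1}\sin\ell\theta\Big]e^{(2n-1){\rm i}\phi}+\frac2N\sum_{(-N+1)/2<n\le0}\Big[\sum_{\ell=1}^{N-1}\beta_\ell^{2n-1+2N}\sin\ell\theta\Big]e^{(2n-1){\rm i}\phi},\end{aligned}$$ where the coefficients are computed as follows: 1. $(f_{j,m})_{m=0}^{2N-1}:=\mathbf{iFFT}_{2N}\big((F_{j,k})_{k=0}^{2N-1}\big)$ for $j=0,\dots,N$; 2. $(\alpha_\ell^{2m})_{\ell=0}^{N}:=\mathbf{DCT}_N\big((f_{j,2m})_{j=0}^{N}\big)$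 for $m=0,\dots,N-1$, and $(\beta_\ell^{2n-1})_{\ell=1}^{N-1}:=\mathbf{DST}_N\big((f_{j,2n-1})_{j=1}^{N-1}\big)$ for $n=1,\dots,N$.
   Context: $\mathcal{C}$ is the space of continuous functions $F:\mathbb{R}^2\to\mathbb{C}$ satisfying $F(\theta,\phi)=F(\theta+2\pi,\phi)=F(\theta,\phi+2\pi)$ and $F(\theta,\phi)=F(-\theta,\phi+\pi)$ for all $\theta,\phi\in\mathbb{R}$ (equivalently, continuous functions on the unit sphere in polar coordinates). $\mathbb{D}_N^{\rm e}=\mathrm{span}\{\cos j\theta:0\le j\le N\}$, $\mathbb{D}_N^{\rm o}=\mathrm{span}\{\sin j\theta:1\le j\le N+1\}$ (complex spans). $\chi_N\subset\mathcal{C}$ is the space of all functions $\sum_{-N<m\le N}p_m(\theta)e^{{\rm i}m\phi}$ with $p_m\in\mathbb{D}_N^{\rm e}$ for even $m$, $p_m(0)=p_m(\pi)=0$ for even $m\ne0$, and $p_m\in\mathbb{D}_{N-2}^{\rm o}$ for odd $m$. The notation $\sum''$ means the usual sum with the first and last terms halved. The transforms are $$(\mathbf{DST}_N(\mathbf{y}))_j=\sum_{k=1}^{N-1}y_k\sin\frac{kj\pi}{N}\quad(j=1,\dots,N-1),\qquad(\mathbf{DCT}_N(\mathbf{x}))_j=\sum_{k=0}^{N}{}''\,x_k\cos\frac{kj\pi}{N}\quad(j=0,\dots,N),$$ $$(\mathbf{iFFT}_M(\mathbf{z}))_j=\frac1M\sum_{k=0}^{M-1}z_k\exp\Big(-\frac{2kj\pi\,{\rm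 i}}{M}\Big)\quad(j=0,\dots,M-1).$$
   Formalization: F is also required to be constant in φ at θ=0 and θ=π, so that C really is the space of continuous functions on the sphere; the listed identities alone admit F=cos 2φ, for which no interpolant in χ_N exists. *)

theory Defs
  imports "HOL-Analysis.Analysis"
begin

(* Continuous functions on the unit sphere in polar coordinates.  The periodicity and glide
   symmetry alone do not force F to be constant on the lines theta = 0 and theta = pi (for
   instance F (theta, phi) = cos (2 * phi) satisfies them), although these lines are mapped to
   the two poles; hence the two pole conditions.  Lemma sphere_fun_iff shows that the resulting
   space is exactly the space of continuous functions on the sphere. *)
definition sphere_fun :: "(real \<times> real \<Rightarrow> complex) set" where
  "sphere_fun = {F. continuous_on UNIV F \<and>
     (\<forall>\<theta> \<phi>. F (\<theta>, \<phi>) = F (\<theta> + 2 * pi, \<phi>)) \<and>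
     (\<forall>\<theta> \<phi>. F (\<theta>, \<phi>) = F (\<theta>, \<phi> + 2 * pi)) \<and>
     (\<forall>\<theta> \<phi>. F (\<theta>, \<phi>) = F (- \<theta>, \<phi> + pi)) \<and>
     (\<forall>\<phi> \<phi>'. F (0, \<phi>) = F (0, \<phi>')) \<and>
     (\<forall>\<phi> \<phi>'. F (pi, \<phi>) = F (pi, \<phi>'))}"

definition polar :: "real \<times> real \<Rightarrow> real \<times> real \<times> real" where
  "polar = (\<lambda>(\<theta>, \<phi>). (sin \<theta> * cos \<phi>, sin \<theta> * sin \<phi>, cos \<theta>))"

(* Complex linear spans, written out as the sets of all linear combinations. *)
definition D_even :: "nat \<Rightarrow> (real \<Rightarrow> complex) set" where
  "D_even N = {p. \<exists>c :: nat \<Rightarrow> complex.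
     p = (\<lambda>\<theta>. \<Sum>j=0..N. c j * complex_of_real (cos (real j * \<theta>)))}"

definition D_odd :: "nat \<Rightarrow> (real \<Rightarrow> complex) set" where
  "D_odd N = {p. \<exists>c :: nat \<Rightarrow> complex.
     p = (\<lambda>\<theta>. \<Sum>j=1..N+1. c j * complex_of_real (sin (real j * \<theta>)))}"

(* Only meaningful for N >= 2, because of the truncated subtraction N - 2. *)
definition chi :: "nat \<Rightarrow> (real \<times> real \<Rightarrow> complex) set" where
  "chi N = {Q. \<exists>p :: int \<Rightarrow> real \<Rightarrow> complex.
     (\<forall>m\<in>{- int N<..int N}.
        (even m \<longrightarrow> p m \<in> D_even N) \<and>
        (even m \<and> m \<noteq> 0 \<longrightarrow> p m 0 = 0 \<and> p m pi = 0) \<and>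
        (odd m \<longrightarrow> p m \<in> D_odd (N - 2))) \<and>
     Q = (\<lambda>(\<theta>, \<phi>). \<Sum>m\<in>{- int N<..int N}. p m \<theta> * exp (\<i> * of_int m * of_real \<phi>))}"

(* The sum over k = 0, ..., N with the first and the last term halved. *)
definition sum_halved :: "nat \<Rightarrow> (nat \<Rightarrow> complex) \<Rightarrow> complex" where
  "sum_halved N f = (\<Sum>k=0..N. if k = 0 \<or> k = N then f k / 2 else f k)"

definition DST :: "nat \<Rightarrow> (nat \<Rightarrow> complex) \<Rightarrow> nat \<Rightarrow> complex" where
  "DST N y j = (\<Sum>k=1..N-1. y k * of_real (sin (real k * real j * pi / real N)))"

definition DCT :: "nat \<Rightarrow> (nat \<Rightarrow> complex) \<Rightarrow> nat \<Rightarrow> complex" where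
  "DCT N x j = sum_halved N (\<lambda>k. x k * of_real (cos (real k * real j * pi / real N)))"

definition iFFT :: "nat \<Rightarrow> (nat \<Rightarrow> complex) \<Rightarrow> nat \<Rightarrow> complex" where
  "iFFT M z j = 1 / of_nat M *
     (\<Sum>k=0..M-1. z k * exp (- (2 * of_nat k * of_nat j * of_real pi * \<i>) / of_nat M))"

(* The common grid spacing: theta_j = node N j and phi_k = node N k. *)
definition node :: "nat \<Rightarrow> nat \<Rightarrow> real" where
  "node N j = real j * pi / real N"

definition fcoeff :: "nat \<Rightarrow> (real \<times> real \<Rightarrow> complex) \<Rightarrow> nat \<Rightarrow> nat \<Rightarrow> complex" where
  "fcoeff N F j m = iFFT (2 * N) (\<lambda>k. F (node N j, node N k)) m"

(* In alpha N F m l and beta N F m l, m is the upper index (even for alpha, odd for beta)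
   and l is the lower one. *)
definition alpha :: "nat \<Rightarrow> (real \<times> real \<Rightarrow> complex) \<Rightarrow> nat \<Rightarrow> nat \<Rightarrow> complex" where
  "alpha N F m l = DCT N (\<lambda>j. fcoeff N F j m) l"

definition beta :: "nat \<Rightarrow> (real \<times> real \<Rightarrow> complex) \<Rightarrow> nat \<Rightarrow> nat \<Rightarrow> complex" where
  "beta N F m l = DST N (\<lambda>j. fcoeff N F j m) l"

lemma shift_int:
  fixes g :: "real \<Rightarrow> 'a"
  assumes "\<And>x. g x = g (x + c)"
  shows "g (x + of_int n * c) = g x"
proof (induction n rule: int_induct[where k = 0])
  case base
  show ?case by simp
next
  case (step1 i)
  have "g (x + of_int i * c) = g (x + of_int (i + 1) * c)"
    using assms[of "x + of_int i * c"] by (simp add: algebra_simps)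
  with step1 show ?case by simp
next
  case (step2 i)
  have "g (x + of_int (i - 1) * c) = g (x + of_int i * c)"
    using assms[of "x + of_int (i - 1) * c"] by (simp add: algebra_simps)
  with step2 show ?case by simp
qed

lemma polar_in_sphere: "polar x \<in> sphere 0 1"
proof -
  obtain t p where x: "x = (t, p)" by (cases x)
  have "(sin t * cos p)\<^sup>2 + ((sin t * sin p)\<^sup>2 + (cos t)\<^sup>2)
      = (sin t)\<^sup>2 * ((sin p)\<^sup>2 + (cos p)\<^sup>2) + (cos t)\<^sup>2"
    unfolding power_mult_distrib distrib_left by (simp only: add_ac)
  also have "\<dots> = 1" by simp
  finally show ?thesis by (simp add: x polar_def norm_Pair)
qed

lemma polar_image: "polar ` ({0..pi} \<times> {0..2*pi}) = sphere 0 1"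
proof (intro equalityI subsetI)
  fix v assume "v \<in> polar ` ({0..pi} \<times> {0..2*pi})"
  then obtain t p where v: "v = (sin t * cos p, sin t * sin p, cos t)"
    by (auto simp: polar_def)
  then show "v \<in> sphere 0 1" using polar_in_sphere[of "(t, p)"] by (simp add: v polar_def)
next
  fix v :: "real \<times> real \<times> real" assume "v \<in> sphere 0 1"
  then obtain x y z where v: "v = (x, y, z)" and n: "x\<^sup>2 + (y\<^sup>2 + z\<^sup>2) = 1"
    by (cases v) (auto simp: norm_Pair)
  have "z\<^sup>2 \<le> 1" using n sum_power2_ge_zero[of x y] by linarith
  then have z: "-1 \<le> z" "z \<le> 1" using abs_square_le_1[of z] by auto
  define t where "t = arccos z"
  have t: "t \<in> {0..pi}" "cos t = z"
    using z by (auto simp: t_def arccos_lbound arccos_ubound)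
  have s: "x\<^sup>2 + y\<^sup>2 = (sin t)\<^sup>2"
    using n t(2) sin_cos_squared_add[of t] by auto
  have "\<exists>p\<in>{0..2*pi}. x = sin t * cos p \<and> y = sin t * sin p"
  proof (cases "sin t = 0")
    case True
    with s have "x = 0" "y = 0" by (auto simp: sum_power2_eq_zero_iff)
    with True show ?thesis by (auto intro!: bexI[of _ 0])
  next
    case False
    then have "(x / sin t)\<^sup>2 + (y / sin t)\<^sup>2 = 1"
      using s by (simp add: power_divide add_divide_distrib[symmetric])
    from sincos_total_2pi[OF this] obtain p where
      "0 \<le> p" "p < 2 * pi" "x / sin t = cos p" "y / sin t = sin p" by metis
    with False show ?thesis by (auto simp: field_simps intro!: bexI[of _ p])
  qed
  then obtain p where "p \<in> {0..2*pi}" "x = sin t * cos p" "y = sin t * sin p" by auto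
  with t show "v \<in> polar ` ({0..pi} \<times> {0..2*pi})"
    by (auto simp: v polar_def intro!: image_eqI[of _ _ "(t, p)"])
qed

lemma sphere_fun_respects_polar:
  assumes F: "F \<in> sphere_fun" and eq: "polar (a, b) = polar (c, d)"
  shows "F (a, b) = F (c, d)"
proof -
  have s1: "F (x + of_int n * (2 * pi), y) = F (x, y)" for x y n
    using F by (intro shift_int[where g = "\<lambda>x. F (x, y)"]) (auto simp: sphere_fun_def)
  have s2: "F (x, y + of_int n * (2 * pi)) = F (x, y)" for x y n
    using F by (intro shift_int[where g = "\<lambda>y. F (x, y)"]) (auto simp: sphere_fun_def)
  have s3: "F (- x, y + pi) = F (x, y)" for x y
    using F by (auto simp: sphere_fun_def)
  have p0: "F (0, x) = F (0, y)" and p1: "F (pi, x) = F (pi, y)" for x y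
    using F unfolding sphere_fun_def by blast+
  have ang: "\<exists>n::int. v = u + of_int n * (2 * pi)"
    if "cos u = cos v" "sin u = sin v" for u v :: real
  proof -
    from that obtain n :: int where "u = v + 2 * pi * of_int n"
      using sin_cos_eq_iff[of u v] by auto
    then have "v = u + of_int (- n) * (2 * pi)" by (simp add: algebra_simps)
    then show ?thesis by blast
  qed
  have e: "sin a * cos b = sin c * cos d" "sin a * sin b = sin c * sin d" "cos a = cos c"
    using eq by (auto simp: polar_def)
  have "(sin a)\<^sup>2 = (sin c)\<^sup>2" using e(3) by (simp add: sin_squared_eq)
  then consider "sin a = sin c" | "sin c = - sin a" by (auto simp: power2_eq_iff)
  then show ?thesis
  proof cases
    case 1
    with e ang obtain n :: int where c: "c = a + of_int n * (2 * pi)" by blast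
    show ?thesis
    proof (cases "sin a = 0")
      case True
      show ?thesis
      proof (cases "cos a = 1")
        case True
        then obtain k :: int where "a = 0 + of_int k * (2 * pi)"
          using ang[of 0 a] \<open>sin a = 0\<close> by auto
        then show ?thesis unfolding c s1 by (metis s1 p0)
      next
        case False
        then have "cos a = cos pi" using \<open>sin a = 0\<close> sin_cos_squared_add[of a]
          by (auto simp: power2_eq_1_iff)
        then obtain k :: int where "a = pi + of_int k * (2 * pi)"
          using ang[of pi a] \<open>sin a = 0\<close> by auto
        then show ?thesis unfolding c s1 by (metis s1 p1)
      qed
    next
      case False
      then obtain k :: int where "d = b + of_int k * (2 * pi)"
        using e 1 ang[of b d] by auto
      then show ?thesis by (simp only: c s1 s2)
    qed
  next
    case 2
    with e ang[of "- a" c] obtain n :: int where c: "c = - a + of_int n * (2 * pi)" by auto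
    show ?thesis
    proof (cases "sin a = 0")
      case True
      show ?thesis
      proof (cases "cos a = 1")
        case True
        then obtain k :: int where "a = 0 + of_int k * (2 * pi)"
          using ang[of 0 a] \<open>sin a = 0\<close> by auto
        then have "F (a, y) = F (0, y)" for y by (metis s1)
        moreover have "F (- a, y) = F (a, y - pi)" for y using s3[of a "y - pi"] by simp
        ultimately show ?thesis unfolding c s1 by (metis p0)
      next
        case False
        then have "cos a = cos pi" using \<open>sin a = 0\<close> sin_cos_squared_add[of a]
          by (auto simp: power2_eq_1_iff)
        then obtain k :: int where "a = pi + of_int k * (2 * pi)"
          using ang[of pi a] \<open>sin a = 0\<close> by auto
        then have "F (a, y) = F (pi, y)" for y by (metis s1)
        moreover have "F (- a, y) = F (a, y - pi)" for y using s3[of a "y - pi"] by simp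
        ultimately show ?thesis unfolding c s1 by (metis p1)
      qed
    next
      case False
      have "sin a * (cos b + cos d) = 0" "sin a * (sin b + sin d) = 0"
        using e 2 by (simp_all add: distrib_left)
      with False have "cos d = - cos b" "sin d = - sin b"
        by (simp_all add: eq_neg_iff_add_eq_0 add.commute)
      then obtain k :: int where "d = (b + pi) + of_int k * (2 * pi)"
        using ang[of "b + pi" d] by auto
      then show ?thesis by (simp only: c s1 s2 s3)
    qed
  qed
qed

lemma sphere_fun_iff:
  "F \<in> sphere_fun \<longleftrightarrow> (\<exists>f. continuous_on (sphere 0 1) f \<and> F = f \<circ> polar)"
proof
  assume F: "F \<in> sphere_fun"
  define K where "K = {0..pi} \<times> {0..2*pi}"
  define f where "f v = F (SOME x. polar x = v)" for v
  have cF: "continuous_on UNIV F" using F by (simp add: sphere_fun_def)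
  have cp: "continuous_on UNIV polar"
    unfolding polar_def case_prod_unfold by (intro continuous_intros)
  have Ff: "F x = f (polar x)" for x
  proof -
    have "polar (SOME y. polar y = polar x) = polar x" by (rule someI[of _ x]) simp
    then show ?thesis
      unfolding f_def by (metis F sphere_fun_respects_polar surj_pair)
  qed
  have im: "polar ` K = sphere 0 1" unfolding K_def by (rule polar_image)
  have "continuous_on (sphere 0 1) f"
    unfolding continuous_on_closed_invariant
  proof (intro allI impI)
    fix B :: "complex set" assume "closed B"
    then have "closed (F -` B)" using cF by (simp add: closed_vimage)
    moreover have "compact K" unfolding K_def by (intro compact_Times) auto
    ultimately have "compact (polar ` (K \<inter> F -` B))"
      by (intro compact_continuous_image continuous_on_subset[OF cp] compact_Int_closed) auto
    then have "closed (polar ` (K \<inter> F -` B))" by (rule compact_imp_closed)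
    moreover have "polar ` (K \<inter> F -` B) \<inter> sphere 0 1 = f -` B \<inter> sphere 0 1"
      using Ff unfolding im[symmetric] by auto
    ultimately show "\<exists>A. closed A \<and> A \<inter> sphere 0 1 = f -` B \<inter> sphere 0 1" by blast
  qed
  moreover have "F = f \<circ> polar" using Ff by auto
  ultimately show "\<exists>f. continuous_on (sphere 0 1) f \<and> F = f \<circ> polar" by blast
next
  assume "\<exists>f. continuous_on (sphere 0 1) f \<and> F = f \<circ> polar"
  then obtain f where f: "continuous_on (sphere 0 1) f" "F = f \<circ> polar" by blast
  have cp: "continuous_on UNIV polar"
    unfolding polar_def case_prod_unfold by (intro continuous_intros)
  have "range polar \<subseteq> sphere 0 1" using polar_in_sphere by blast
  then have "continuous_on UNIV F"
    unfolding f(2) by (intro continuous_on_compose cp continuous_on_subset[OF f(1)])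
  then show "F \<in> sphere_fun"
    by (simp add: sphere_fun_def f(2) polar_def)
qed

lemma chi_subset_sphere_fun: "chi N \<subseteq> sphere_fun"
proof
  fix Q assume "Q \<in> chi N"
  then obtain p :: "int \<Rightarrow> real \<Rightarrow> complex" where
    p: "\<And>m. m \<in> {- int N<..int N} \<Longrightarrow> (even m \<longrightarrow> p m \<in> D_even N) \<and>
        (even m \<and> m \<noteq> 0 \<longrightarrow> p m 0 = 0 \<and> p m pi = 0) \<and>
        (odd m \<longrightarrow> p m \<in> D_odd (N - 2))" and
    Q: "Q = (\<lambda>(\<theta>, \<phi>). \<Sum>m\<in>{- int N<..int N}. p m \<theta> * exp (\<i> * of_int m * of_real \<phi>))"
    unfolding chi_def by blast
  have cosp: "cos (real j * (x + 2 * pi)) = cos (real j * x)" for j x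
    using cos.plus_of_nat[of "real j * x" j] by (simp add: algebra_simps)
  have sinp: "sin (real j * (x + 2 * pi)) = sin (real j * x)" for j x
    using sin.plus_of_nat[of "real j * x" j] by (simp add: algebra_simps)
  have cont: "continuous_on UNIV (p m)"
    and per: "p m (x + 2 * pi) = p m x"
    and refl: "p m (- x) = (if even m then p m x else - p m x)"
    and pole: "m \<noteq> 0 \<Longrightarrow> p m 0 = 0 \<and> p m pi = 0"
    if "m \<in> {- int N<..int N}" for m x
  proof -
    show "continuous_on UNIV (p m)"
      using p[OF that] by (cases "even m") (auto simp: D_even_def D_odd_def intro!: continuous_intros)
    show "p m (x + 2 * pi) = p m x"
      using p[OF that] by (cases "even m") (auto simp: D_even_def D_odd_def cosp sinp
        simp del: sum.cl_ivl_Suc)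
    show "p m (- x) = (if even m then p m x else - p m x)"
      using p[OF that] by (cases "even m") (auto simp: D_even_def D_odd_def sum_negf[symmetric]
        simp del: sum.cl_ivl_Suc)
    show "m \<noteq> 0 \<Longrightarrow> p m 0 = 0 \<and> p m pi = 0"
      using p[OF that] by (cases "even m") (auto simp: D_odd_def simp del: sum.cl_ivl_Suc)
  qed
  have e2: "exp (\<i> * of_int m * of_real (y + 2 * pi)) = exp (\<i> * of_int m * of_real y)" for m y
  proof -
    have "\<i> * of_int m * of_real (y + 2 * pi)
        = \<i> * of_int m * of_real y + 2 * of_real pi * \<i> * of_int m"
      by (simp add: algebra_simps)
    moreover have "exp (2 * of_real pi * \<i> * of_int m) = 1"
      using exp_integer_2pi[of "of_int m"] by (simp add: mult_ac)
    ultimately show ?thesis by (simp only: exp_add)  simp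
  qed
  have e1: "exp (\<i> * of_int m * of_real (y + pi))
      = (if even m then 1 else -1) * exp (\<i> * of_int m * of_real y)" for m y
  proof -
    have "exp (\<i> * of_int m * of_real pi) = (if even m then 1 else -1)"
    proof -
      have "exp (\<i> * of_int m * of_real pi) = cis (pi * of_int m)"
        by (simp add: cis_conv_exp mult_ac)
      then show ?thesis by (simp add: complex_eq_iff cos_int_times_real sin_int_times_real)
    qed
    then show ?thesis by (simp add: distrib_left exp_add mult.commute)
  qed
  have pc: "Q (t, y) = p 0 t" if "t = 0 \<or> t = pi" "N \<ge> 1" for t y
  proof -
    have "Q (t, y) = (\<Sum>m\<in>{0}. p m t * exp (\<i> * of_int m * of_real y))"
      unfolding Q prod.case
    proof (intro sum.mono_neutral_right ballI)
      fix m assume "m \<in> {- int N<..int N} - {0}"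
      then have "p m t = 0" using that(1) pole[of m] by auto
      then show "p m t * exp (\<i> * of_int m * of_real y) = 0" by simp
    qed (use that in auto)
    then show ?thesis by simp
  qed
  have pc0: "Q (t, y) = 0" if "N = 0" for t y
    using that by (simp add: Q)
  have "continuous_on UNIV Q"
    unfolding Q case_prod_unfold
    by (intro continuous_intros continuous_on_compose2[OF cont]) auto
  moreover have "Q (t, y) = Q (t + 2 * pi, y)" for t y
    unfolding Q prod.case by (intro sum.cong HOL.refl) (simp only: per)
  moreover have "Q (t, y) = Q (t, y + 2 * pi)" for t y
    unfolding Q prod.case by (simp only: e2)
  moreover have "Q (t, y) = Q (- t, y + pi)" for t y
    unfolding Q prod.case by (intro sum.cong HOL.refl) (simp add: refl e1 del: of_real_add)
  moreover have "Q (0, y) = Q (0, y')" "Q (pi, y) = Q (pi, y')" for y y'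
    using pc pc0 by (cases "N = 0"; simp)+
  ultimately show "Q \<in> sphere_fun" unfolding sphere_fun_def by blast
qed

end

(* On the grid, the functions e^{i m phi} with -N < m <= N are orthogonal, and so are the cosines
   cos(l theta), 0 <= l <= N, with halved endpoints, and the sines sin(l theta), 1 <= l <= N-1.
   Hence discrete Fourier inversion in phi identifies p_m(theta_j) with f_{j, m mod 2N}, and cosine
   or sine inversion in theta identifies p_m; this gives both uniqueness and the formula.
   For existence, the function defined by the formula lies in the space because F is constant on
   the lines theta = 0 and theta = pi, so that f_{0,m} = f_{N,m} = 0 for m not divisible by 2N:
   this gives p_m(0) = p_m(pi) = 0 for even m, and for odd m it makes the sine polynomial, which
   vanishes there automatically, interpolate at the poles as well. *)

theory Submission
  imports Defs "HOL-Library.Real_Mod"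
begin

section \<open>Orthogonality of exponentials, cosines and sines on the grid\<close>

lemma sum_cis_roots_of_unity:
  fixes r :: int
  assumes "M > 0"
  shows "(\<Sum>k<M. cis (2 * pi * of_int r * real k / real M)) = (if int M dvd r then of_nat M else 0)"
proof -
  define w where "w = cis (2 * pi * of_int r / real M)"
  have pow: "cis (2 * pi * of_int r * real k / real M) = w ^ k" for k
    unfolding w_def Complex.DeMoivre by (simp add: mult_ac)
  have one: "w ^ M = 1"
    using assms by (simp add: w_def Complex.DeMoivre)
  have iff: "w = 1 \<longleftrightarrow> int M dvd r"
  proof -
    have "w = 1 \<longleftrightarrow> (\<exists>n. 2 * pi * of_int r / real M = of_int n * (2 * pi))"
      by (simp add: w_def cis_eq_1_iff)
    also have "\<dots> \<longleftrightarrow> (\<exists>n. real_of_int r = real_of_int (int M * n))"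
      using assms by (intro ex_cong1) (auto simp: field_simps)
    also have "\<dots> \<longleftrightarrow> int M dvd r"
      by (simp only: of_int_eq_iff dvd_def)
    finally show ?thesis .
  qed
  show ?thesis
    \<comment> \<open>The sum is geometric with ratio \<open>w\<close>: for \<open>w\<close> = 1
      every term is 1, otherwise its numerator 1 - \<open>w ^ M\<close> vanishes.\<close>
    unfolding pow by (cases "w = 1") (use iff one in \<open>auto simp: sum_gp_strict\<close>)
qed

lemma sum_cis_full_period:
  fixes r :: int
  assumes "N > 0"
  shows "(\<Sum>k<2*N. cis (of_int r * node N k)) = (if 2 * int N dvd r then 2 * of_nat N else 0)"
proof -
  have "cis (of_int r * node N k) = cis (2 * pi * of_int r * real k / real (2 * N))" for k
    using assms by (simp add: node_def field_simps)
  with sum_cis_roots_of_unity[of "2 * N" r] assms show ?thesis by simp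
qed

lemma sum_cos_full_period:
  fixes r :: int
  assumes "N > 0"
  shows "(\<Sum>k<2*N. cos (of_int r * node N k)) = (if 2 * int N dvd r then 2 * real N else 0)"
  using arg_cong[OF sum_cis_full_period[OF assms, of r], of Re] by (simp split: if_splits)

text \<open>Cosine is even and periodic. This reflection is what folds a sum over a full period into
  a halved sum over 0, ..., \<open>N\<close>.\<close>

lemma cos_reflect_node:
  assumes "N > 0" "k \<le> 2 * N"
  shows "cos (of_int r * node N (2 * N - k)) = cos (of_int r * node N k)"
proof -
  have "of_int r * node N (2 * N - k) = - (of_int r * node N k) + 2 * pi * of_int r"
    using assms by (simp add: node_def field_simps)
  then show ?thesis
    by (simp only: cos_add cos_int_2pin sin_int_2pin cos_minus)
qed

lemma sum_halved_split:
  assumes "N > 0"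
  shows "sum_halved N f = (f 0 + f N) / 2 + (\<Sum>k=1..N-1. f k)"
proof -
  have s: "{0..N} = insert 0 (insert N {1..N-1})" using assms by auto
  have "(\<Sum>k=1..N-1. if k = 0 \<or> k = N then f k / 2 else f k) = (\<Sum>k=1..N-1. f k)"
    by (intro sum.cong) auto
  with assms show ?thesis
    unfolding sum_halved_def s by (simp add: add_divide_distrib)
qed

text \<open>The reflection k -> 2N - k pairs the indices 1, ..., N - 1 with N + 1, ..., 2N - 1,
  while 0 and N occur once in the full period. This accounts for the halved end terms and reduces
  orthogonality to sums over roots of unity.\<close>

lemma sum_halved_eq_half_full_period:
  assumes "N > 0" and "\<And>k. k \<le> N \<Longrightarrow> h (2 * N - k) = h k"
  shows "sum_halved N h = (\<Sum>k<2*N. h k) / 2"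
proof -
  have "{..<2*N} = insert 0 (insert N ({1..N-1} \<union> {N+1..2*N-1}))" using assms by auto
  then have "(\<Sum>k<2*N. h k) = h 0 + (h N + ((\<Sum>k=1..N-1. h k) + (\<Sum>k=N+1..2*N-1. h k)))"
    using assms(1) by (simp add: sum.union_disjoint)
  also have "(\<Sum>k=N+1..2*N-1. h k) = (\<Sum>k=1..N-1. h k)"
    by (rule sum.reindex_bij_witness[where i = "\<lambda>k. 2 * N - k" and j = "\<lambda>k. 2 * N - k"])
       (use assms in \<open>auto simp flip: assms(2)\<close>)
  finally show ?thesis
    using assms(1) by (simp add: sum_halved_split field_simps)
qed

lemma zero_if_dvd_less:
  fixes b d :: int
  assumes "b dvd d" "\<bar>d\<bar> < b"
  shows "d = 0"
  using dvd_imp_le_int[of d b] assms by force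

text \<open>The sum of the two indices lies between 0 and 2N and reaches an end only when both are 0
  or both are N. This exceptional case is what doubles the squared norm of the first and last
  cosine.\<close>

lemma dvd_2N_diff_iff:
  assumes "j \<le> N" "l \<le> N" "N > 0"
  shows "2 * int N dvd int j - int l \<longleftrightarrow> j = l"
    and "2 * int N dvd int j + int l \<longleftrightarrow> (j = 0 \<or> j = N) \<and> j = l"
proof -
  show "2 * int N dvd int j - int l \<longleftrightarrow> j = l"
    using zero_if_dvd_less[of "2 * int N" "int j - int l"] assms by auto
  show "2 * int N dvd int j + int l \<longleftrightarrow> (j = 0 \<or> j = N) \<and> j = l"
    using zero_if_dvd_less[of "2 * int N" "int j + int l"] assms by (cases "j = N \<and> l = N") auto
qed

text \<open>The product formula gives cosines of frequencies j - l and j + l. On the diagonal the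
  first contributes N/2; the second adds another N/2 exactly for j = 0 and j = N.\<close>

lemma cos_orthogonal_nodes:
  assumes N: "N > 0" and "j \<le> N" "l \<le> N"
  shows "sum_halved N (\<lambda>k. of_real (cos (real j * node N k) * cos (real l * node N k)))
       = (if j = l then if j = 0 \<or> j = N then of_nat N else of_nat N / 2 else 0)"
proof -
  define h where "h r k = cos (real_of_int r * node N k)" for r k
  have refl: "h r (2 * N - k) = h r k" if "k \<le> N" for r k
    unfolding h_def using N that by (intro cos_reflect_node) auto
  have cc: "cos (real j * node N k) * cos (real l * node N k)
      = (h (int j - int l) k + h (int j + int l) k) / 2" for k
    by (simp add: h_def cos_times_cos algebra_simps)
  have "sum_halved N (\<lambda>k. of_real ((h (int j - int l) k + h (int j + int l) k) / 2))
      = of_real (\<Sum>k<2*N. (h (int j - int l) k + h (int j + int l) k) / 2) / 2"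
    using N by (subst sum_halved_eq_half_full_period) (simp_all add: refl)
  also have "(\<Sum>k<2*N. (h (int j - int l) k + h (int j + int l) k) / 2)
      = ((\<Sum>k<2*N. h (int j - int l) k) + (\<Sum>k<2*N. h (int j + int l) k)) / 2"
    by (simp add: sum.distrib flip: sum_divide_distrib)
  also have "\<dots> = ((if j = l then 2 * real N else 0) + (if (j = 0 \<or> j = N) \<and> j = l then 2 * real N else 0)) / 2"
    unfolding h_def sum_cos_full_period[OF N] dvd_2N_diff_iff[OF assms(2,3) N] ..
  finally have eq: "sum_halved N (\<lambda>k. of_real ((h (int j - int l) k + h (int j + int l) k) / 2)) = \<dots> / 2"
    by simp
  show ?thesis
    unfolding cc eq by auto
qed

lemma sin_orthogonal_nodes:
  assumes "j \<in> {1..N-1}" "l \<in> {1..N-1}"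
  shows "(\<Sum>k=1..N-1. of_real (sin (real j * node N k) * sin (real l * node N k)))
       = (if j = l then of_nat N / 2 else 0 :: complex)"
proof -
  have N: "N > 0" and le: "j \<le> N" "l \<le> N" using assms by auto
  define h where "h r k = cos (real_of_int r * node N k)" for r k
  have refl: "h r (2 * N - k) = h r k" if "k \<le> N" for r k
    unfolding h_def using N that by (intro cos_reflect_node) auto
  have ss: "sin (real j * node N k) * sin (real l * node N k)
      = (h (int j - int l) k - h (int j + int l) k) / 2" for k
    by (simp add: h_def sin_times_sin algebra_simps)
  \<comment> \<open>The sines vanish at both end nodes, so the plain sum is also a halved sum and
    folds to a full period as in the cosine case.\<close>
  have z: "sin (real j * node N 0) = 0" "sin (real j * node N N) = 0"
    using N by (auto simp: node_def)
  have "(\<Sum>k=1..N-1. complex_of_real (sin (real j * node N k) * sin (real l * node N k)))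
      = sum_halved N (\<lambda>k. of_real (sin (real j * node N k) * sin (real l * node N k)))"
    using N by (simp add: sum_halved_split z)
  also have "\<dots> = of_real (\<Sum>k<2*N. (h (int j - int l) k - h (int j + int l) k) / 2) / 2"
    unfolding ss
    using N by (subst sum_halved_eq_half_full_period) (simp_all add: refl)
  also have "(\<Sum>k<2*N. (h (int j - int l) k - h (int j + int l) k) / 2)
      = ((\<Sum>k<2*N. h (int j - int l) k) - (\<Sum>k<2*N. h (int j + int l) k)) / 2"
    by (simp add: sum_subtractf flip: sum_divide_distrib)
  also have "\<dots> = (if j = l then real N else 0)"
    unfolding h_def sum_cos_full_period[OF N] dvd_2N_diff_iff[OF le N] using assms by auto
  finally show ?thesis
    by (cases "j = l") simp_all
qed

section \<open>Algebra of halved sums\<close>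

lemma sum_halved_cong: "(\<And>k. k \<le> N \<Longrightarrow> f k = g k) \<Longrightarrow> sum_halved N f = sum_halved N g"
  unfolding sum_halved_def by (intro sum.cong) auto

lemma sum_halved_mult_left: "c * sum_halved N f = sum_halved N (\<lambda>k. c * f k)"
  unfolding sum_halved_def sum_distrib_left by (intro sum.cong) auto

lemma sum_halved_mult_right: "sum_halved N f * c = sum_halved N (\<lambda>k. f k * c)"
  unfolding sum_halved_def sum_distrib_right by (intro sum.cong) auto

lemma sum_halved_sum: "sum_halved N (\<lambda>k. \<Sum>j\<in>A. f j k) = (\<Sum>j\<in>A. sum_halved N (f j))"
  unfolding sum_halved_def
  by (subst sum.swap) (auto intro!: sum.cong simp: sum_divide_distrib)

lemma sum_halved_swap:
  "sum_halved N (\<lambda>k. sum_halved N (f k)) = sum_halved N (\<lambda>j. sum_halved N (\<lambda>k. f k j))"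
proof -
  \<comment> \<open>Writing the halving as a weight turns a halved sum into an ordinary weighted
    sum, so that finite sums can be interchanged.\<close>
  define w :: "nat \<Rightarrow> complex" where "w k = (if k = 0 \<or> k = N then 1 / 2 else 1)" for k
  have *: "sum_halved N g = (\<Sum>k=0..N. w k * g k)" for g
    unfolding sum_halved_def by (intro sum.cong) (auto simp: w_def)
  have "(\<Sum>k=0..N. \<Sum>j=0..N. w k * (w j * f k j)) = (\<Sum>j=0..N. \<Sum>k=0..N. w k * (w j * f k j))"
    by (rule sum.swap)
  then show ?thesis
    by (simp add: * sum_distrib_left mult.left_commute)
qed

lemma sum_halved_delta:
  assumes "l \<le> N"
  shows "sum_halved N (\<lambda>j. if j = l then g j else 0) = (if l = 0 \<or> l = N then g l / 2 else g l)"
proof -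
  have "sum_halved N (\<lambda>j. if j = l then g j else 0)
      = (\<Sum>j=0..N. if j = l then if j = 0 \<or> j = N then g j / 2 else g j else 0)"
    unfolding sum_halved_def by (intro sum.cong) auto
  with assms show ?thesis by simp
qed

text \<open>Frequency and grid index enter the kernels symmetrically. Hence the same orthogonality
  relations serve for sums over nodes and for sums over frequencies.\<close>

lemma node_swap: "real j * node N k = real k * node N j"
  by (simp add: node_def)

section \<open>Inversion of the cosine and sine transforms\<close>

lemma DCT_eq: "DCT N x j = sum_halved N (\<lambda>k. x k * of_real (cos (real k * node N j)))"
  by (simp add: DCT_def node_def mult_ac)

lemma DST_eq: "DST N y j = (\<Sum>k=1..N-1. y k * of_real (sin (real k * node N j)))"
  by (simp add: DST_def node_def mult_ac)

lemma DCT_inversion: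
  assumes "N > 0" "j \<le> N"
  shows "2 / of_nat N * sum_halved N (\<lambda>l. DCT N x l * of_real (cos (real l * node N j))) = x j"
proof -
  have "sum_halved N (\<lambda>l. DCT N x l * of_real (cos (real l * node N j)))
     = sum_halved N (\<lambda>l. sum_halved N (\<lambda>k.
         x k * of_real (cos (real k * node N l) * cos (real j * node N l))))"
    by (simp only: DCT_eq sum_halved_mult_right node_swap[of _ N j] of_real_mult mult.assoc)
  also have "\<dots> = sum_halved N (\<lambda>k. x k * sum_halved N (\<lambda>l.
         of_real (cos (real k * node N l) * cos (real j * node N l))))"
    unfolding sum_halved_mult_left by (rule sum_halved_swap)
  \<comment> \<open>Only k = j survives. At the two ends the doubled factor N meets the halved
    weight, so every j yields \<open>x j\<close> times N/2.\<close>
  also have "\<dots> = sum_halved N (\<lambda>k. if k = j then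
      x k * (if k = 0 \<or> k = N then of_nat N else of_nat N / 2) else 0)"
    using assms by (intro sum_halved_cong, subst cos_orthogonal_nodes) auto
  finally show ?thesis
    using assms by (simp add: sum_halved_delta)
qed

lemma DST_inversion:
  assumes "j \<in> {1..N-1}"
  shows "2 / of_nat N * (\<Sum>l=1..N-1. DST N y l * of_real (sin (real l * node N j))) = y j"
proof -
  have "(\<Sum>l=1..N-1. DST N y l * of_real (sin (real l * node N j)))
     = (\<Sum>k=1..N-1. y k * (\<Sum>l=1..N-1.
         of_real (sin (real k * node N l) * sin (real j * node N l))))"
    unfolding DST_eq sum_distrib_right sum_distrib_left
    by (subst sum.swap) (simp add: node_swap[of _ N j] mult_ac)
  also have "\<dots> = (\<Sum>k=1..N-1. if k = j then y k * (of_nat N / 2) else 0)"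
    using assms by (intro sum.cong refl, subst sin_orthogonal_nodes) auto
  also have "\<dots> = y j * (of_nat N / 2)"
    using assms by simp
  finally have "(\<Sum>l=1..N-1. DST N y l * of_real (sin (real l * node N j))) = y j * (of_nat N / 2)" .
  moreover have "N > 0"
    using assms by auto
  ultimately show ?thesis
    by (simp only:) simp
qed

text \<open>Converse direction to \<open>DCT_inversion\<close>: the transform of the node values
  recovers the coefficients of a cosine polynomial, so its N + 1 node values determine it.
  Uniqueness rests on this.\<close>

lemma D_even_eq_DCT:
  assumes "N > 0" "p \<in> D_even N"
  shows "p \<theta> = 2 / of_nat N * sum_halved N (\<lambda>l. DCT N (\<lambda>j. p (node N j)) l * of_real (cos (real l * \<theta>)))"
proof -
  obtain c where p: "p = (\<lambda>\<theta>. \<Sum>j=0..N. c j * complex_of_real (cos (real j * \<theta>)))"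
    using assms by (auto simp: D_even_def)
  have D: "DCT N (\<lambda>j. p (node N j)) l = c l * (if l = 0 \<or> l = N then of_nat N else of_nat N / 2)"
    if "l \<le> N" for l
  proof -
    have "DCT N (\<lambda>j. p (node N j)) l = (\<Sum>j=0..N. c j * sum_halved N (\<lambda>k.
        of_real (cos (real j * node N k) * cos (real l * node N k))))"
      by (simp add: DCT_eq p sum_distrib_right sum_halved_sum sum_halved_mult_left node_swap[of _ N l] mult.assoc)
    also have "\<dots> = (\<Sum>j=0..N. if j = l then
        c j * (if j = 0 \<or> j = N then of_nat N else of_nat N / 2) else 0)"
      using assms that by (intro sum.cong refl, subst cos_orthogonal_nodes) auto
    finally show ?thesis using that by simp
  qed
  have "2 / of_nat N * sum_halved N (\<lambda>l. DCT N (\<lambda>j. p (node N j)) l * of_real (cos (real l * \<theta>)))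
     = 2 / of_nat N * sum_halved N (\<lambda>l. c l * (if l = 0 \<or> l = N then of_nat N else of_nat N / 2)
          * of_real (cos (real l * \<theta>)))"
    using D by (intro arg_cong2[where f = "(*)"] refl sum_halved_cong) simp
  \<comment> \<open>The halving of the end terms cancels the doubled factor that \<open>D\<close>
    gives for l = 0 and l = N.\<close>
  also have "\<dots> = p \<theta>"
    unfolding p sum_halved_mult_left sum_halved_def
    using assms(1) unfolding sum_distrib_left by (intro sum.cong) auto
  finally show ?thesis by simp
qed

lemma D_odd_eq_DST:
  assumes "N \<ge> 2" "p \<in> D_odd (N - 2)"
  shows "p \<theta> = 2 / of_nat N * (\<Sum>l=1..N-1. DST N (\<lambda>j. p (node N j)) l * of_real (sin (real l * \<theta>)))"
proof -
  \<comment> \<open>The frequencies of \<open>D_odd (N - 2)\<close> are 1, ..., N - 1, as many as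
    there are interior nodes.\<close>
  have "N - 2 + 1 = N - 1" using assms by simp
  then obtain c where p: "p = (\<lambda>\<theta>. \<Sum>j=1..N-1. c j * complex_of_real (sin (real j * \<theta>)))"
    using assms(2) unfolding D_odd_def by auto
  have D: "DST N (\<lambda>j. p (node N j)) l = c l * (of_nat N / 2)"
    if "l \<in> {1..N-1}" for l
  proof -
    have "DST N (\<lambda>j. p (node N j)) l = (\<Sum>j=1..N-1. c j * (\<Sum>k=1..N-1.
        of_real (sin (real j * node N k) * sin (real l * node N k))))"
      unfolding DST_eq p sum_distrib_right sum_distrib_left
      by (subst sum.swap) (simp add: node_swap[of _ N l] mult.assoc)
    also have "\<dots> = (\<Sum>j=1..N-1. if j = l then c j * (of_nat N / 2) else 0)"
      using assms that by (intro sum.cong refl, subst sin_orthogonal_nodes) auto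
    finally show ?thesis using that by simp
  qed
  show ?thesis
    unfolding p[THEN fun_cong, of \<theta>] sum_distrib_left
    using assms(1) by (intro sum.cong) (auto simp: D)
qed

section \<open>Discrete Fourier inversion in the longitude\<close>

lemma iFFT_eq:
  assumes "N > 0"
  shows "iFFT (2 * N) z j = 1 / (2 * of_nat N) * (\<Sum>k<2*N. z k * cis (- (real j * node N k)))"
proof -
  have "{0..2 * N - 1} = {..<2 * N}" using assms by auto
  moreover have "exp (- (2 * of_nat k * of_nat j * of_real pi * \<i>) / of_nat (2 * N))
      = cis (- (real j * node N k))" for k
    using assms by (simp add: cis_conv_exp node_def field_simps)
  ultimately show ?thesis
    by (simp add: iFFT_def)
qed

text \<open>Frequencies that differ by a multiple of 2N agree on the grid. This links the window -N
  < m <= N of \<open>chi\<close> with the indices 0, ..., 2N - 1 of \<open>iFFT\<close>.\<close>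

lemma cis_mod_node:
  fixes m :: int
  assumes "N > 0"
  shows "cis (- (real (nat (m mod (2 * int N))) * node N k)) = cis (- (of_int m * node N k))"
proof -
  define d where "d = m div (2 * int N)"
  have "int (nat (m mod (2 * int N))) = m - 2 * int N * d"
    using assms by (simp add: d_def minus_mult_div_eq_mod)
  then have "real (nat (m mod (2 * int N))) = of_int (m - 2 * int N * d)"
    by linarith
  then have "- (real (nat (m mod (2 * int N))) * node N k)
      = - (of_int m * node N k) + 2 * pi * of_int (d * int k)"
    using assms by (simp only:) (simp add: node_def field_simps)
  moreover have "cis (2 * pi * of_int (d * int k)) = 1"
    by (intro cis_multiple_2pi Ints_of_int)
  ultimately show ?thesis
    by (simp only: cis_mult[symmetric]) simp
qed

lemma sum_cis_window:
  fixes r :: int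
  assumes "N > 0"
  shows "(\<Sum>m\<in>{- int N<..int N}. cis (of_int m * (of_int r * pi / real N)))
       = (if 2 * int N dvd r then 2 * of_nat N else 0)"
proof -
  \<comment> \<open>The window is 0, ..., 2N - 1 shifted by 1 - N. The shift contributes a constant
    phase, which is 1 if 2N divides \<open>r\<close> and otherwise multiplies a vanishing
    sum.\<close>
  define c where "c = cis (of_int (1 - int N) * (of_int r * pi / real N))"
  have "(\<Sum>m\<in>{- int N<..int N}. cis (of_int m * (of_int r * pi / real N)))
      = (\<Sum>i<2*N. cis (of_int (int i + (1 - int N)) * (of_int r * pi / real N)))"
    by (rule sum.reindex_bij_witness[where i = "\<lambda>i. int i + (1 - int N)"
          and j = "\<lambda>m. nat (m - (1 - int N))"]) auto
  also have "\<dots> = c * (\<Sum>i<2*N. cis (of_int r * node N i))"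
    unfolding c_def sum_distrib_left cis_mult
    by (intro sum.cong refl arg_cong[where f = cis]) (simp add: node_def field_simps)
  also have "\<dots> = (if 2 * int N dvd r then 2 * of_nat N else 0)"
  proof (cases "2 * int N dvd r")
    case True
    then obtain q where "r = 2 * int N * q" by blast
    then have "of_int (1 - int N) * (of_int r * pi / real N) = 2 * pi * of_int ((1 - int N) * q)"
      using assms by (simp add: field_simps)
    then have "c = 1"
      unfolding c_def by (metis cis_multiple_2pi Ints_of_int)
    with sum_cis_full_period[OF assms, of r] show ?thesis by simp
  qed (simp add: sum_cis_full_period[OF assms])
  finally show ?thesis .
qed

lemma dvd_window_diff_iff:
  assumes "m \<in> {- int N<..int N}" "m' \<in> {- int N<..int N}"
  shows "2 * int N dvd m - m' \<longleftrightarrow> m = m'"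
  using zero_if_dvd_less[of "2 * int N" "m - m'"] assms by auto

text \<open>Orthogonality over the nodes: the transform reads off the coefficients of an exponential
  sum. It serves uniqueness and the vanishing of coefficients at the poles.\<close>

lemma iFFT_exponential_sum:
  assumes "N > 0" and m: "m \<in> {- int N<..int N}"
  shows "iFFT (2 * N) (\<lambda>k. \<Sum>m'\<in>{- int N<..int N}. c m' * cis (of_int m' * node N k))
           (nat (m mod (2 * int N))) = c m"
proof -
  let ?W = "{- int N<..int N}"
  have "(\<Sum>k<2*N. (\<Sum>m'\<in>?W. c m' * cis (of_int m' * node N k)) * cis (- (of_int m * node N k)))
      = (\<Sum>m'\<in>?W. c m' * (\<Sum>k<2*N. cis (of_int (m' - m) * node N k)))"
    unfolding sum_distrib_left sum_distrib_right
    by (subst sum.swap) (simp add: cis_mult algebra_simps)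
  also have "\<dots> = (\<Sum>m'\<in>?W. if m' = m then c m' * (2 * of_nat N) else 0)"
    using m by (intro sum.cong refl)
      (simp only: sum_cis_full_period[OF assms(1)] dvd_window_diff_iff, simp)
  also have "\<dots> = c m * (2 * of_nat N)"
    using m by simp
  finally show ?thesis
    unfolding iFFT_eq[OF assms(1)] cis_mod_node[OF assms(1)]
    using assms(1) by (simp only:) simp
qed

text \<open>Orthogonality over the frequencies: the transform coefficients reproduce the data. It
  serves existence.\<close>

lemma exponential_sum_iFFT:
  assumes "N > 0" "k < 2 * N"
  shows "(\<Sum>m\<in>{- int N<..int N}. iFFT (2 * N) z (nat (m mod (2 * int N))) * cis (of_int m * node N k))
       = z k"
proof -
  let ?W = "{- int N<..int N}"
  have "(\<Sum>m\<in>?W. (\<Sum>i<2*N. z i * cis (- (of_int m * node N i))) * cis (of_int m * node N k))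
      = (\<Sum>i<2*N. z i * (\<Sum>m\<in>?W. cis (of_int m * (of_int (int k - int i) * pi / real N))))"
    unfolding sum_distrib_left sum_distrib_right
    by (subst sum.swap) (simp add: cis_mult node_def algebra_simps diff_divide_distrib)
  also have "\<dots> = (\<Sum>i<2*N. if i = k then z i * (2 * of_nat N) else 0)"
  proof (intro sum.cong refl)
    fix i assume "i \<in> {..<2*N}"
    then have "2 * int N dvd int k - int i \<longleftrightarrow> i = k"
      using zero_if_dvd_less[of "2 * int N" "int k - int i"] assms by auto
    then show "z i * (\<Sum>m\<in>?W. cis (of_int m * (of_int (int k - int i) * pi / real N)))
        = (if i = k then z i * (2 * of_nat N) else 0)"
      by (simp only: sum_cis_window[OF assms(1)]) simp
  qed
  also have "\<dots> = z k * (2 * of_nat N)"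
    using assms by simp
  finally have eq: "(\<Sum>m\<in>?W. (\<Sum>i<2*N. z i * cis (- (of_int m * node N i))) * cis (of_int m * node N k))
      = z k * (2 * of_nat N)" .
  show ?thesis
    unfolding iFFT_eq[OF assms(1)] cis_mod_node[OF assms(1)] mult.assoc sum_distrib_left[symmetric] eq
    using assms(1) by simp
qed

section \<open>Construction of the interpolant and existence\<close>

definition interp_coeff :: "nat \<Rightarrow> (real \<times> real \<Rightarrow> complex) \<Rightarrow> int \<Rightarrow> real \<Rightarrow> complex" where
  "interp_coeff N F m \<theta> = 2 / of_nat N *
     (let i = nat (m mod (2 * int N)) in
      if even m then sum_halved N (\<lambda>l. alpha N F i l * of_real (cos (real l * \<theta>)))
      else \<Sum>l=1..N-1. beta N F i l * of_real (sin (real l * \<theta>)))"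

text \<open>The four sums of the formula are collected into one sum over the frequency window, the
  shape that \<open>chi\<close> asks for. Reduction modulo 2N inside \<open>interp_coeff\<close>
  supplies the upper index of the transform coefficients.\<close>

definition interpolant :: "nat \<Rightarrow> (real \<times> real \<Rightarrow> complex) \<Rightarrow> real \<times> real \<Rightarrow> complex" where
  "interpolant N F = (\<lambda>(\<theta>, \<phi>).
     \<Sum>m\<in>{- int N<..int N}. interp_coeff N F m \<theta> * exp (\<i> * of_int m * of_real \<phi>))"

text \<open>On a pole \<open>F\<close> does not depend on the longitude, so its row of data is an
  exponential sum with frequency 0 only.\<close>

lemma fcoeff_pole:
  assumes F: "F \<in> sphere_fun" and "N > 0" "j = 0 \<or> j = N"
    and m: "m \<in> {- int N<..int N}" "m \<noteq> 0"
  shows "fcoeff N F j (nat (m mod (2 * int N))) = 0"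
proof -
  define c where "c m = (if m = 0 then F (node N j, 0) else 0)" for m :: int
  have "node N j = 0 \<or> node N j = pi"
    using assms by (auto simp: node_def)
  then have "F (node N j, \<phi>) = F (node N j, 0)" for \<phi>
    using F unfolding sphere_fun_def by auto
  moreover have "(\<Sum>m'\<in>{- int N<..int N}. c m' * cis (of_int m' * node N k)) = F (node N j, 0)" for k
  proof -
    have "(\<Sum>m'\<in>{- int N<..int N}. c m' * cis (of_int m' * node N k))
        = (\<Sum>m'\<in>{- int N<..int N}. if m' = 0 then F (node N j, 0) else 0)"
      by (intro sum.cong) (auto simp: c_def)
    with assms show ?thesis by simp
  qed
  ultimately have eq: "F (node N j, node N k)
      = (\<Sum>m'\<in>{- int N<..int N}. c m' * cis (of_int m' * node N k))" for k
    by (rule trans[OF _ sym])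
  have "fcoeff N F j (nat (m mod (2 * int N))) = c m"
    unfolding fcoeff_def eq by (rule iFFT_exponential_sum[OF \<open>N > 0\<close> m(1)])
  with m(2) show ?thesis
    by (simp add: c_def)
qed

lemma interp_coeff_node:
  assumes "F \<in> sphere_fun" "N > 0" "j \<le> N" "m \<in> {- int N<..int N}"
  shows "interp_coeff N F m (node N j) = fcoeff N F j (nat (m mod (2 * int N)))"
proof (cases "even m")
  case True
  then show ?thesis
    using DCT_inversion[OF assms(2,3)] by (simp add: interp_coeff_def alpha_def)
next
  case False
  show ?thesis
  \<comment> \<open>\<open>DST_inversion\<close> covers the interior nodes only. At the poles every
    sine vanishes, and so does the Fourier coefficient, since an odd frequency is nonzero.\<close>
  proof (cases "j = 0 \<or> j = N")
    case True
    then have "sin (real l * node N j) = 0" for l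
      using \<open>N > 0\<close> by (auto simp: node_def)
    moreover have "m \<noteq> 0" using False by auto
    ultimately show ?thesis
      using fcoeff_pole[OF assms(1,2) True assms(4)] False by (simp add: interp_coeff_def)
  next
    case inner: False
    then have "j \<in> {1..N-1}" using assms by auto
    from DST_inversion[OF this] False show ?thesis
      by (simp add: interp_coeff_def beta_def Let_def del: One_nat_def)
  qed
qed

lemma exp_node: "exp (\<i> * of_int m * of_real (node N k)) = cis (of_int m * node N k)"
  by (simp add: cis_conv_exp mult.assoc)

lemma interpolant_node:
  assumes "F \<in> sphere_fun" "N > 0" "j \<le> N" "k < 2 * N"
  shows "interpolant N F (node N j, node N k) = F (node N j, node N k)"
proof -
  have "interpolant N F (node N j, node N k)
      = (\<Sum>m\<in>{- int N<..int N}. fcoeff N F j (nat (m mod (2 * int N))) * cis (of_int m * node N k))"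
    unfolding interpolant_def prod.case exp_node
    using assms by (intro sum.cong) (simp_all add: interp_coeff_node)
  then show ?thesis
    using assms by (simp add: fcoeff_def exponential_sum_iFFT)
qed

lemma interpolant_in_chi:
  assumes "F \<in> sphere_fun" "N \<ge> 2"
  shows "interpolant N F \<in> chi N"
proof -
  have N: "N > 0" using assms by simp
  have even_case: "interp_coeff N F m \<in> D_even N" if "even m" for m
    unfolding D_even_def mem_Collect_eq
  proof (intro exI ext)
    let ?a = "\<lambda>j. 2 / of_nat N * alpha N F (nat (m mod (2 * int N))) j"
    show "interp_coeff N F m \<theta> = (\<Sum>j=0..N. (if j = 0 \<or> j = N then ?a j / 2 else ?a j)
        * complex_of_real (cos (real j * \<theta>)))" for \<theta>
      using that unfolding interp_coeff_def Let_def sum_halved_def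
      by (simp only: if_True sum_distrib_left) (intro sum.cong, auto)
  qed
  have odd_case: "interp_coeff N F m \<in> D_odd (N - 2)" if "odd m" for m
    unfolding D_odd_def mem_Collect_eq
  proof (intro exI ext)
    have "N - 2 + 1 = N - 1" using assms by simp
    then show "interp_coeff N F m \<theta> = (\<Sum>j=1..N-2+1.
        (2 / of_nat N * beta N F (nat (m mod (2 * int N))) j) * complex_of_real (sin (real j * \<theta>)))" for \<theta>
      using that unfolding interp_coeff_def Let_def
      by (simp only: if_False sum_distrib_left mult.assoc)
  qed
  \<comment> \<open>Both poles are grid nodes, so the values there are Fourier coefficients, which
    \<open>fcoeff_pole\<close> makes zero.\<close>
  have pole: "interp_coeff N F m 0 = 0 \<and> interp_coeff N F m pi = 0"
    if "m \<in> {- int N<..int N}" "m \<noteq> 0" for m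
  proof -
    have "node N 0 = 0" "node N N = pi" using N by (simp_all add: node_def)
    with interp_coeff_node[OF assms(1) N _ that(1)] fcoeff_pole[OF assms(1) N _ that]
    show ?thesis by (metis le0 order_refl)
  qed
  show ?thesis
    unfolding chi_def mem_Collect_eq interpolant_def
    using even_case odd_case pole by blast
qed

section \<open>Uniqueness\<close>

lemma interpolant_unique:
  assumes "N \<ge> 2" "Q \<in> chi N"
    and interp: "\<And>j k. j \<le> N \<Longrightarrow> k < 2 * N \<Longrightarrow> Q (node N j, node N k) = F (node N j, node N k)"
  shows "Q = interpolant N F"
proof -
  have N: "N > 0" using assms by simp
  obtain p where
    p: "\<And>m. m \<in> {- int N<..int N} \<Longrightarrow> (even m \<longrightarrow> p m \<in> D_even N) \<and>
        (even m \<and> m \<noteq> 0 \<longrightarrow> p m 0 = 0 \<and> p m pi = 0) \<and>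
        (odd m \<longrightarrow> p m \<in> D_odd (N - 2))" and
    Q: "Q = (\<lambda>(\<theta>, \<phi>). \<Sum>m\<in>{- int N<..int N}. p m \<theta> * exp (\<i> * of_int m * of_real \<phi>))"
    using assms(2) unfolding chi_def by blast
  \<comment> \<open>For fixed j the row of \<open>Q\<close> on the grid is an exponential sum with
    coefficients \<open>p m (node N j)\<close>. It has the same data as \<open>F\<close>, so the
    transform of \<open>F\<close> returns these coefficients.\<close>
  have val: "fcoeff N F j (nat (m mod (2 * int N))) = p m (node N j)"
    if "j \<le> N" "m \<in> {- int N<..int N}" for j m
  proof -
    have "fcoeff N F j (nat (m mod (2 * int N)))
        = iFFT (2 * N) (\<lambda>k. Q (node N j, node N k)) (nat (m mod (2 * int N)))"
      unfolding fcoeff_def iFFT_eq[OF N] using that(1) interp by simp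
    then show ?thesis
      by (simp add: Q exp_node iFFT_exponential_sum[OF N that(2)])
  qed
  \<comment> \<open>With the node values known, cosine or sine inversion, according to the parity of
    \<open>m\<close>, fixes \<open>p m\<close> everywhere.\<close>
  have "p m \<theta> = interp_coeff N F m \<theta>" if m: "m \<in> {- int N<..int N}" for m \<theta>
  proof (cases "even m")
    case True
    have "alpha N F (nat (m mod (2 * int N))) l = DCT N (\<lambda>j. p m (node N j)) l" for l
      unfolding alpha_def DCT_eq using val[OF _ m] by (intro sum_halved_cong) simp
    moreover have "p m \<in> D_even N"
      using p[OF m] True by blast
    ultimately show ?thesis
      unfolding interp_coeff_def Let_def if_P[OF True]
      using D_even_eq_DCT[OF N, of "p m" \<theta>] by (simp only:)
  next
    case False
    have "beta N F (nat (m mod (2 * int N))) l = DST N (\<lambda>j. p m (node N j)) l" for l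
      unfolding beta_def DST_eq by (intro sum.cong) (auto simp: val[OF _ m])
    moreover have "p m \<in> D_odd (N - 2)"
      using p[OF m] False by blast
    ultimately show ?thesis
      unfolding interp_coeff_def Let_def if_not_P[OF False]
      using D_odd_eq_DST[OF assms(1), of "p m" \<theta>] by (simp only:)
  qed
  then show ?thesis
    unfolding Q interpolant_def by (intro ext) auto
qed

section \<open>Passage from the frequency window to the four explicit sums\<close>

lemma half_window_sets:
  "{m. 0 \<le> m \<and> real_of_int m \<le> real N / 2} = {m. 0 \<le> m \<and> 2 * m \<le> int N}"
  "{m. - (real N / 2) < real_of_int m \<and> m \<le> - 1} = {m. - int N < 2 * m \<and> m \<le> - 1}"
  "{n. 1 \<le> n \<and> real_of_int n \<le> (real N + 1) / 2} = {n. 1 \<le> n \<and> 2 * n - 1 \<le> int N}"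
  "{n. (- real N + 1) / 2 < real_of_int n \<and> n \<le> 0} = {n. - int N < 2 * n - 1 \<and> n \<le> 0}"
proof -
  have "2 * m \<le> int N \<longleftrightarrow> real_of_int (2 * m) \<le> of_int (int N)"
    "- int N < 2 * m \<longleftrightarrow> real_of_int (- int N) < of_int (2 * m)"
    "2 * m - 1 \<le> int N \<longleftrightarrow> real_of_int (2 * m - 1) \<le> of_int (int N)"
    "- int N < 2 * m - 1 \<longleftrightarrow> real_of_int (- int N) < of_int (2 * m - 1)" for m
    by (simp_all only: of_int_le_iff of_int_less_iff)
  then show
    "{m. 0 \<le> m \<and> real_of_int m \<le> real N / 2} = {m. 0 \<le> m \<and> 2 * m \<le> int N}"
    "{m. - (real N / 2) < real_of_int m \<and> m \<le> - 1} = {m. - int N < 2 * m \<and> m \<le> - 1}"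
    "{n. 1 \<le> n \<and> real_of_int n \<le> (real N + 1) / 2} = {n. 1 \<le> n \<and> 2 * n - 1 \<le> int N}"
    "{n. (- real N + 1) / 2 < real_of_int n \<and> n \<le> 0} = {n. - int N < 2 * n - 1 \<and> n \<le> 0}"
    by (auto simp: field_simps)
qed

text \<open>Even frequencies are written 2m and odd ones 2n - 1. Each parity is also split by sign,
  because negative frequencies receive a different transform index.\<close>

lemma sum_window_parity_split:
  fixes g :: "int \<Rightarrow> complex"
  assumes "N > 0"
  shows "(\<Sum>m\<in>{- int N<..int N}. g m)
      = (\<Sum>m | 0 \<le> m \<and> 2 * m \<le> int N. g (2 * m))
      + (\<Sum>m | - int N < 2 * m \<and> m \<le> - 1. g (2 * m))
      + (\<Sum>n | 1 \<le> n \<and> 2 * n - 1 \<le> int N. g (2 * n - 1))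
      + (\<Sum>n | - int N < 2 * n - 1 \<and> n \<le> 0. g (2 * n - 1))"
proof -
  define A B C D :: "int set" where
    sets: "A = {m. 0 \<le> m \<and> 2 * m \<le> int N}" "B = {m. - int N < 2 * m \<and> m \<le> - 1}"
    "C = {n. 1 \<le> n \<and> 2 * n - 1 \<le> int N}" "D = {n. - int N < 2 * n - 1 \<and> n \<le> 0}"
  have "finite A" "finite B" "finite C" "finite D"
    by (rule finite_subset[of _ "{- int N..int N + 1}"]; force simp: sets)+
  have e: "(\<Sum>m\<in>A. g (2 * m)) + (\<Sum>m\<in>B. g (2 * m)) = (\<Sum>m\<in>A \<union> B. g (2 * m))"
    by (rule sum.union_disjoint[symmetric]) (use \<open>finite A\<close> \<open>finite B\<close> in \<open>auto simp: sets\<close>)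
  have o: "(\<Sum>n\<in>C. g (2 * n - 1)) + (\<Sum>n\<in>D. g (2 * n - 1)) = (\<Sum>n\<in>C \<union> D. g (2 * n - 1))"
    by (rule sum.union_disjoint[symmetric]) (use \<open>finite C\<close> \<open>finite D\<close> in \<open>auto simp: sets\<close>)
  have "(\<Sum>m\<in>{- int N<..int N}. g m)
      = (\<Sum>m\<in>{- int N<..int N} \<inter> {m. even m}. g m) + (\<Sum>m\<in>{- int N<..int N} - {m. even m}. g m)"
    by (rule sum.Int_Diff) simp
  also have "(\<Sum>m\<in>{- int N<..int N} \<inter> {m. even m}. g m) = (\<Sum>m\<in>A \<union> B. g (2 * m))"
    by (rule sum.reindex_bij_witness[where i = "\<lambda>m. 2 * m" and j = "\<lambda>m. m div 2"])
       (use assms in \<open>auto simp: sets\<close>)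
  also have "(\<Sum>m\<in>{- int N<..int N} - {m. even m}. g m) = (\<Sum>n\<in>C \<union> D. g (2 * n - 1))"
    by (rule sum.reindex_bij_witness[where i = "\<lambda>n. 2 * n - 1" and j = "\<lambda>m. (m + 1) div 2"])
       (auto simp: sets add.commute elim!: oddE)
  finally show ?thesis
    unfolding sets[symmetric] using e o by (simp add: add.assoc)
qed

text \<open>Source of the shift by 2N in the upper indices of the second and fourth sums, whose
  frequencies are negative.\<close>

lemma window_mod:
  fixes m :: int
  assumes "m \<in> {- int N<..int N}"
  shows "m mod (2 * int N) = (if m < 0 then m + 2 * int N else m)"
proof (cases "m < 0")
  case True
  have "m mod (2 * int N) = (m + 2 * int N) mod (2 * int N)" by simp
  also have "\<dots> = m + 2 * int N" using assms True by (intro mod_pos_pos_trivial) auto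
  finally show ?thesis using True by simp
qed (use assms in \<open>auto intro!: mod_pos_pos_trivial\<close>)

lemma interpolant_formula:
  assumes "N > 0"
  shows "interpolant N F (\<theta>, \<phi>) =
                2 / of_nat N * (\<Sum>m | 0 \<le> m \<and> real_of_int m \<le> real N / 2.
                  sum_halved N (\<lambda>l. alpha N F (nat (2 * m)) l * of_real (cos (real l * \<theta>)))
                    * exp (2 * of_int m * \<i> * of_real \<phi>))
              + 2 / of_nat N * (\<Sum>m | - (real N / 2) < real_of_int m \<and> m \<le> - 1.
                  sum_halved N (\<lambda>l. alpha N F (nat (2 * m + 2 * int N)) l * of_real (cos (real l * \<theta>)))
                    * exp (2 * of_int m * \<i> * of_real \<phi>))
              + 2 / of_nat N * (\<Sum>n | 1 \<le> n \<and> real_of_int n \<le> (real N + 1) / 2.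
                  (\<Sum>l=1..N-1. beta N F (nat (2 * n - 1)) l * of_real (sin (real l * \<theta>)))
                    * exp ((2 * of_int n - 1) * \<i> * of_real \<phi>))
              + 2 / of_nat N * (\<Sum>n | (- real N + 1) / 2 < real_of_int n \<and> n \<le> 0.
                  (\<Sum>l=1..N-1. beta N F (nat (2 * n - 1 + 2 * int N)) l * of_real (sin (real l * \<theta>)))
                    * exp ((2 * of_int n - 1) * \<i> * of_real \<phi>))"
proof -
  have ev: "exp (\<i> * of_int (2 * m) * of_real \<phi>) = exp (2 * of_int m * \<i> * of_real \<phi>)" for m
    by (simp add: mult_ac)
  have od: "exp (\<i> * of_int (2 * n - 1) * of_real \<phi>) = exp ((2 * of_int n - 1) * \<i> * of_real \<phi>)" for n
    by (simp add: mult_ac)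
  show ?thesis
    unfolding interpolant_def prod.case half_window_sets sum_window_parity_split[OF assms] sum_distrib_left ev od
  proof (intro arg_cong2[where f = "(+)"] sum.cong refl)
    fix m assume "m \<in> {m. 0 \<le> m \<and> 2 * m \<le> int N}"
    then have mem: "2 * m \<in> {- int N<..int N}" and "0 \<le> m"
      using assms by auto
    then show "interp_coeff N F (2 * m) \<theta> * exp (2 * of_int m * \<i> * of_real \<phi>) =
        2 / of_nat N * (sum_halved N (\<lambda>l. alpha N F (nat (2 * m)) l * of_real (cos (real l * \<theta>)))
          * exp (2 * of_int m * \<i> * of_real \<phi>))"
      unfolding interp_coeff_def window_mod[OF mem] by simp
  next
    fix m assume "m \<in> {m. - int N < 2 * m \<and> m \<le> - 1}"
    then show "interp_coeff N F (2 * m) \<theta> * exp (2 * of_int m * \<i> * of_real \<phi>) =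
        2 / of_nat N * (sum_halved N (\<lambda>l. alpha N F (nat (2 * m + 2 * int N)) l * of_real (cos (real l * \<theta>)))
          * exp (2 * of_int m * \<i> * of_real \<phi>))"
      using window_mod[of "2 * m" N] by (auto simp: interp_coeff_def)
  next
    fix n assume "n \<in> {n. 1 \<le> n \<and> 2 * n - 1 \<le> int N}"
    then show "interp_coeff N F (2 * n - 1) \<theta> * exp ((2 * of_int n - 1) * \<i> * of_real \<phi>) =
        2 / of_nat N * ((\<Sum>l=1..N-1. beta N F (nat (2 * n - 1)) l * of_real (sin (real l * \<theta>)))
          * exp ((2 * of_int n - 1) * \<i> * of_real \<phi>))"
      using window_mod[of "2 * n - 1" N] by (auto simp: interp_coeff_def)
  next
    fix n assume "n \<in> {n. - int N < 2 * n - 1 \<and> n \<le> 0}"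
    then show "interp_coeff N F (2 * n - 1) \<theta> * exp ((2 * of_int n - 1) * \<i> * of_real \<phi>) =
        2 / of_nat N * ((\<Sum>l=1..N-1. beta N F (nat (2 * n - 1 + 2 * int N)) l * of_real (sin (real l * \<theta>)))
          * exp ((2 * of_int n - 1) * \<i> * of_real \<phi>))"
      using window_mod[of "2 * n - 1" N] by (auto simp: interp_coeff_def)
  qed
qed

theorem proposition2p1:
  fixes N :: nat and F :: "real \<times> real \<Rightarrow> complex"
  assumes "N \<ge> 2" and "F \<in> sphere_fun"
  shows "(\<exists>!Q. Q \<in> chi N \<and>
            (\<forall>j\<in>{0..N}. \<forall>k\<in>{0..2*N-1}. Q (node N j, node N k) = F (node N j, node N k))) \<and>
         (\<forall>Q. Q \<in> chi N \<and>
            (\<forall>j\<in>{0..N}. \<forall>k\<in>{0..2*N-1}. Q (node N j, node N k) = F (node N j, node N k)) \<longrightarrow>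
            (\<forall>\<theta> \<phi>. Q (\<theta>, \<phi>) =
                2 / of_nat N * (\<Sum>m | 0 \<le> m \<and> real_of_int m \<le> real N / 2.
                  sum_halved N (\<lambda>l. alpha N F (nat (2 * m)) l * of_real (cos (real l * \<theta>)))
                    * exp (2 * of_int m * \<i> * of_real \<phi>))
              + 2 / of_nat N * (\<Sum>m | - (real N / 2) < real_of_int m \<and> m \<le> - 1.
                  sum_halved N (\<lambda>l. alpha N F (nat (2 * m + 2 * int N)) l * of_real (cos (real l * \<theta>)))
                    * exp (2 * of_int m * \<i> * of_real \<phi>))
              + 2 / of_nat N * (\<Sum>n | 1 \<le> n \<and> real_of_int n \<le> (real N + 1) / 2.
                  (\<Sum>l=1..N-1. beta N F (nat (2 * n - 1)) l * of_real (sin (real l * \<theta>)))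
                    * exp ((2 * of_int n - 1) * \<i> * of_real \<phi>))
              + 2 / of_nat N * (\<Sum>n | (- real N + 1) / 2 < real_of_int n \<and> n \<le> 0.
                  (\<Sum>l=1..N-1. beta N F (nat (2 * n - 1 + 2 * int N)) l * of_real (sin (real l * \<theta>)))
                    * exp ((2 * of_int n - 1) * \<i> * of_real \<phi>))))"
proof -
  let ?P = "\<lambda>Q. Q \<in> chi N \<and>
      (\<forall>j\<in>{0..N}. \<forall>k\<in>{0..2*N-1}. Q (node N j, node N k) = F (node N j, node N k))"
  have ex: "?P (interpolant N F)"
    using assms interpolant_in_chi interpolant_node by simp
  have uniq: "Q = interpolant N F" if "?P Q" for Q
    using that assms(1) by (intro interpolant_unique) auto
  have N: "N > 0"
    using assms(1) by simp
  show ?thesis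
  proof (intro conjI allI impI)
    show "\<exists>!Q. ?P Q"
      using ex uniq by blast
  \<comment> \<open>Every interpolating \<open>Q\<close> is \<open>interpolant N F\<close>, so the
    formula need only be known for that function.\<close>
  qed (drule uniq, simp only: interpolant_formula[OF N])
qed

end
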